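(* The set of accumulation points (in $\mathbf{R}$) of the set of forbidden rational numbers $q>0$ contains $\frac{3-\sqrt5}{2}$ and $\frac{3+\sqrt5}{2}$.
   Context: For real $q>0$ and an integer sequence $\mathbf{m}=(m_0,\dots,m_k)\in\mathbf{Z}^{k+1}$ ($k\ge 0$) write $\mathbf{m}_j=(m_0,\dots,m_j)$ for $0\le j\le k$. Define $c(q,\mathbf{m})$ recursively by $c(q,(m_0))=m_0$ and $c(q,(m_0,\dots,m_k))=m_k+\frac{1}{q\,c(q,(m_0,\dots,m_{k-1}))}$ for $k\ge1$. The sequence $\mathbf{m}$ is called a path (for $q$) if $c(q,\mathbf{m}_j)\neq0$ for all $0\le j\le k-1$ (so the expression is well defined). A path $\mathbf{m}$ is called a loop if $c(q,\mathbf{m})=0$; the set of loops for $q$ is denoted $L(q)$. The weight of a path is $w(q,\mathbf{m})=q^{k/2}\prod_{j=0}^{k-1}|c(q,\mathbf{m}_j)|$. A number $q>0$ is called forbidden if there exists a loop $\mathbf{m}\in L(q)$ with $w(q,\mathbf{m})\neq1$. *)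

theory Defs
  imports "HOL-Analysis.Analysis"
begin

text \<open>
  A sequence \<open>(m\<^sub>0, \<dots>, m\<^sub>k)\<close> is a nonempty list of length \<open>k + 1\<close>, and its
  truncation \<open>(m\<^sub>0, \<dots>, m\<^sub>j)\<close> is \<open>take (Suc j) m\<close>. The recursion for the value
  removes the last entry. Where the recursion would divide by zero the value is only an
  artefact of \<open>1 / 0 = 0\<close>; such lists, and the empty list, are excluded by \<open>is_path\<close>.
\<close>

fun cfrac_val :: "real \<Rightarrow> int list \<Rightarrow> real" where
  "cfrac_val q m =
     (if length m \<le> 1 then real_of_int (hd m)
      else real_of_int (last m) + 1 / (q * cfrac_val q (butlast m)))"

declare cfrac_val.simps [simp del]

definition is_path :: "real \<Rightarrow> int list \<Rightarrow> bool" where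
  "is_path q m \<longleftrightarrow> m \<noteq> [] \<and> (\<forall>j < length m - 1. cfrac_val q (take (Suc j) m) \<noteq> 0)"

definition loops :: "real \<Rightarrow> int list set" where
  "loops q = {m. is_path q m \<and> cfrac_val q m = 0}"

definition weight :: "real \<Rightarrow> int list \<Rightarrow> real" where
  "weight q m =
     q powr (real (length m - 1) / 2) * (\<Prod>j < length m - 1. \<bar>cfrac_val q (take (Suc j) m)\<bar>)"

definition forbidden :: "real \<Rightarrow> bool" where
  "forbidden q \<longleftrightarrow> q > 0 \<and> (\<exists>m \<in> loops q. weight q m \<noteq> 1)"

end

theory Submission
  imports Defs
begin

text \<open>
  The roots of \<open>D(q) = q\<^sup>2 - 3q + 1\<close> are \<open>(3 \<plusminus> \<surd>5)/2\<close>, and \<open>(1, -1, 1, -1)\<close> has value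
  \<open>D(q) / (q (2 - q))\<close>. Hence \<open>(1, -1, 1, -1, m)\<close> is a loop as soon as \<open>m = (q - 2) / D(q)\<close>
  is an integer, and then its weight is \<open>\<bar>D(q)\<bar>\<close>. For \<open>q = x/y\<close> with integers satisfying the
  Pell-type equation \<open>x\<^sup>2 - 3xy + y\<^sup>2 = -1\<close> we have \<open>D(q) = -1/y\<^sup>2\<close>, so \<open>m\<close> is an integer.
  The map \<open>(x, y) \<mapsto> (y, 3y - x)\<close> produces infinitely many solutions, whose ratios \<open>x/y\<close> and
  \<open>y/x\<close> tend to the two roots of \<open>D\<close>.
\<close>

lemma cfrac_val_singleton: "cfrac_val q [a] = real_of_int a"
  by (simp add: cfrac_val.simps)

lemma cfrac_val_snoc:
  "xs \<noteq> [] \<Longrightarrow> cfrac_val q (xs @ [a]) = real_of_int a + 1 / (q * cfrac_val q xs)"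
  by (subst cfrac_val.simps) (auto simp: Suc_le_eq)

lemma forbidden_if_integral_quotient:
  fixes q :: real and m :: int
  assumes "q > 0" "q \<noteq> 1" "q \<noteq> 2"
    and D0: "q\<^sup>2 - 3 * q + 1 \<noteq> 0" and D1: "\<bar>q\<^sup>2 - 3 * q + 1\<bar> \<noteq> 1"
    and m: "m * (q\<^sup>2 - 3 * q + 1) = q - 2"
  shows "forbidden q"
proof -
  define D where "D = q\<^sup>2 - 3 * q + 1"
  have D: "D \<noteq> 0" "\<bar>D\<bar> \<noteq> 1" "m * D = q - 2"
    using D0 D1 m by (auto simp: D_def)
  have nz: "q \<noteq> 0" "1 - q \<noteq> 0" "2 - q \<noteq> 0"
    using assms by auto
  have v0: "cfrac_val q [1] = 1"
    by (simp add: cfrac_val_singleton)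
  have v1: "cfrac_val q [1, -1] = (1 - q) / q"
    using cfrac_val_snoc[of "[1]" q "-1"] v0 nz by (simp add: diff_divide_distrib)
  have v2: "cfrac_val q [1, -1, 1] = (2 - q) / (1 - q)"
    using cfrac_val_snoc[of "[1, -1]" q 1] v1 nz by (simp add: add_divide_eq_iff)
  have v3: "cfrac_val q [1, -1, 1, -1] = D / (q * (2 - q))"
    using cfrac_val_snoc[of "[1, -1, 1]" q "-1"] v2 nz
    by (simp add: D_def divide_simps) (simp add: algebra_simps power2_eq_square)
  have v4: "cfrac_val q [1, -1, 1, -1, m] = 0"
    using cfrac_val_snoc[of "[1, -1, 1, -1]" q m] v3 nz D
    by (simp add: divide_simps)
  \<comment> \<open>The values \<open>v0\<close> to \<open>v3\<close> are nonzero because q is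
    positive and not 1 or 2, and D is nonzero.\<close>
  have "is_path q [1, -1, 1, -1, m]"
    using assms D v0 v1 v2 v3
    by (auto simp: is_path_def less_Suc_eq numeral_eq_Suc)
  moreover have "weight q [1, -1, 1, -1, m] = \<bar>D\<bar>"
  proof -
    \<comment> \<open>The four proper prefixes contribute q^(4/2) = q^2, and the product of their
      values telescopes to D / q^2.\<close>
    have "weight q [1, -1, 1, -1, m]
        = q\<^sup>2 * \<bar>(1 - q) / q * ((2 - q) / (1 - q)) * (D / (q * (2 - q)))\<bar>"
      using v0 v1 v2 v3 assms(1) by (simp add: weight_def abs_mult powr_numeral)
    moreover have "(1 - q) / q * ((2 - q) / (1 - q)) * (D / (q * (2 - q))) = D / q\<^sup>2"
      using nz by (simp add: power2_eq_square)
    ultimately show ?thesis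
      using nz by (simp add: power2_eq_square)
  qed
  ultimately show ?thesis
    using assms(1) D v4 unfolding forbidden_def loops_def by force
qed

text \<open>Taking y > 1 makes |D(q)| = 1/y^2 less than 1, so the weight differs from 1.\<close>

lemma forbidden_ratio:
  fixes x y :: int
  assumes "x > 0" "y > 1" and e: "x\<^sup>2 - 3 * x * y + y\<^sup>2 = -1"
  shows "forbidden (of_int x / of_int y)"
    and "(of_int x / of_int y :: real)\<^sup>2 - 3 * (of_int x / of_int y) + 1 = - 1 / (of_int y)\<^sup>2" (is "?D = _")
proof -
  have y: "real_of_int y > 1"
    using assms by simp
  have "real_of_int (x\<^sup>2 - 3 * x * y + y\<^sup>2) = -1"
    unfolding e by simp
  then have e': "(real_of_int x)\<^sup>2 - 3 * of_int x * of_int y + (of_int y)\<^sup>2 = -1"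
    by simp
  have "?D = ((real_of_int x)\<^sup>2 - 3 * of_int x * of_int y + (of_int y)\<^sup>2) / (of_int y)\<^sup>2"
    using y by (simp add: field_simps power2_eq_square)
  then show D: "?D = - 1 / (of_int y)\<^sup>2"
    using e' by simp
  have y2: "(real_of_int y)\<^sup>2 > 1"
    using y by (intro one_less_power) auto
  show "forbidden (of_int x / of_int y)"
  proof (rule forbidden_if_integral_quotient)
    show "of_int x / of_int y > (0::real)"
      using assms by simp
    \<comment> \<open>D takes the value -1 at both 1 and 2, whereas here -1 < D(q).\<close>
    show "of_int x / of_int y \<noteq> (1::real)" "of_int x / of_int y \<noteq> (2::real)"
      using D y2 by (auto simp del: times_divide_eq_right)
    show "?D \<noteq> 0" "\<bar>?D\<bar> \<noteq> 1"
      unfolding D using y2 by auto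
    \<comment> \<open>The integer is (q - 2) / D(q) = -(x/y - 2) y^2.\<close>
    show "of_int ((2 * y - x) * y) * ?D = of_int x / of_int y - 2"
      unfolding D using y by (simp add: field_simps power2_eq_square)
  qed
qed

text \<open>The map (x, y) -> (y, 3y - x) preserves the quadratic form. The bound 2x \<le> y
  persists because x \<le> y gives 3y - x \<ge> 2y; it forces growth and later separates the ratios
  from the unwanted root.\<close>

lemma pell_solutions_unbounded:
  "\<exists>x y :: int. x > int n \<and> 2 * x \<le> y \<and> x\<^sup>2 - 3 * x * y + y\<^sup>2 = -1"
proof (induction n)
  case 0
  show ?case
    by (rule exI[of _ 1], rule exI[of _ 2]) simp
next
  case (Suc n)
  then obtain x y :: int
    where "x > int n" "2 * x \<le> y" "x\<^sup>2 - 3 * x * y + y\<^sup>2 = -1"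
    by blast
  then show ?case
    by (intro exI[of _ y] exI[of _ "3 * y - x"]) (simp add: power2_eq_square algebra_simps)
qed

text \<open>
  Since \<open>D(q) = (q - r) (q - r')\<close> with \<open>r'\<close> the other root, \<open>\<bar>q - r\<bar> \<le> \<bar>D(q)\<bar>\<close> whenever \<open>q\<close>
  has distance at least 1 from \<open>r'\<close>.
\<close>

lemma islimpt_forbidden:
  fixes r r' :: real
  assumes roots: "\<And>q. q\<^sup>2 - 3 * q + 1 = (q - r) * (q - r')"
    and approx: "\<And>n. \<exists>x y :: int. x > 0 \<and> y > int (Suc n) \<and> x\<^sup>2 - 3 * x * y + y\<^sup>2 = -1
                   \<and> 1 \<le> \<bar>of_int x / of_int y - r'\<bar>"
  shows "r islimpt {q. q \<in> \<rat> \<and> q > 0 \<and> forbidden q}"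
  unfolding islimpt_approachable
proof (intro allI impI)
  fix e :: real
  assume "e > 0"
  then obtain n where n: "1 / real (Suc n) < e"
    using nat_approx_posE by metis
  obtain x y :: int where xy: "x > 0" "y > int (Suc n)" "x\<^sup>2 - 3 * x * y + y\<^sup>2 = -1"
      and far: "1 \<le> \<bar>of_int x / of_int y - r'\<bar>"
    using approx by blast
  define q :: real where "q = of_int x / of_int y"
  have y: "real_of_int y > real (Suc n)" "y > 1"
    using xy(2) by linarith+
  have D: "(q - r) * (q - r') = - 1 / (of_int y)\<^sup>2"
    using forbidden_ratio(2)[OF xy(1) y(2) xy(3)] unfolding roots q_def .
  have "\<bar>q - r\<bar> * 1 \<le> \<bar>q - r\<bar> * \<bar>q - r'\<bar>"
    using far by (intro mult_left_mono) (auto simp: q_def)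
  also have "\<dots> = 1 / (of_int y)\<^sup>2"
    using arg_cong[OF D, of abs] by (simp add: abs_mult)
  also have "\<dots> \<le> 1 / of_int y"
    using y by (simp add: field_simps power2_eq_square)
  also have "\<dots> \<le> 1 / real (Suc n)"
    using y by (intro divide_left_mono) auto
  finally have "dist q r < e"
    using n by (simp add: dist_real_def)
  moreover have "q \<noteq> r"
    using D y by auto
  moreover have "q \<in> \<rat>" "q > 0" "forbidden q"
    using forbidden_ratio(1)[OF xy(1) y(2) xy(3)] xy(1) y(2) by (auto simp: q_def)
  ultimately show "\<exists>q\<in>{q. q \<in> \<rat> \<and> q > 0 \<and> forbidden q}. q \<noteq> r \<and> dist q r < e"
    by blast
qed

theorem theorem2:
  shows "{(3 - sqrt 5) / 2, (3 + sqrt 5) / 2}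
           \<subseteq> {x :: real. x islimpt {q :: real. q \<in> \<rat> \<and> q > 0 \<and> forbidden q}}"
proof -
  \<comment> \<open>This crude bound puts the roots below 1/2 and above 5/2, up to equality, so x/y
    \<le> 1 and y/x \<ge> 2 each lie at least 3/2 from the opposite root.\<close>
  have s: "2 \<le> sqrt 5"
    by (rule real_le_rsqrt) simp
  have "(3 - sqrt 5) / 2 islimpt {q. q \<in> \<rat> \<and> q > 0 \<and> forbidden q}"
  proof (rule islimpt_forbidden)
    show "q\<^sup>2 - 3 * q + 1 = (q - (3 - sqrt 5) / 2) * (q - (3 + sqrt 5) / 2)" for q
      by (simp add: field_simps power2_eq_square)
    show "\<exists>x y :: int. x > 0 \<and> y > int (Suc n) \<and> x\<^sup>2 - 3 * x * y + y\<^sup>2 = -1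
        \<and> 1 \<le> \<bar>of_int x / of_int y - (3 + sqrt 5) / 2\<bar>" for n
    proof -
      obtain x y :: int
        where xy: "x > int (Suc n)" "2 * x \<le> y" "x\<^sup>2 - 3 * x * y + y\<^sup>2 = -1"
        using pell_solutions_unbounded by blast
      then have "of_int x / of_int y \<le> (1::real)"
        by simp
      moreover have "5 / 2 \<le> (3 + sqrt 5) / 2"
        using s by simp
      ultimately have "1 \<le> \<bar>of_int x / of_int y - (3 + sqrt 5) / 2\<bar>"
        by linarith
      moreover have "x > 0" "y > int (Suc n)"
        using xy by linarith+
      ultimately show ?thesis
        using xy(3) by blast
    qed
  qed
  moreover have "(3 + sqrt 5) / 2 islimpt {q. q \<in> \<rat> \<and> q > 0 \<and> forbidden q}"
  proof (rule islimpt_forbidden)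
    show "q\<^sup>2 - 3 * q + 1 = (q - (3 + sqrt 5) / 2) * (q - (3 - sqrt 5) / 2)" for q
      by (simp add: field_simps power2_eq_square)
    show "\<exists>x y :: int. x > 0 \<and> y > int (Suc n) \<and> x\<^sup>2 - 3 * x * y + y\<^sup>2 = -1
        \<and> 1 \<le> \<bar>of_int x / of_int y - (3 - sqrt 5) / 2\<bar>" for n
    proof -
      obtain x y :: int
        where xy: "x > int (Suc n)" "2 * x \<le> y" "x\<^sup>2 - 3 * x * y + y\<^sup>2 = -1"
        using pell_solutions_unbounded by blast
      have "real_of_int (2 * x) \<le> of_int y" "real_of_int x > 0"
        using xy by linarith+
      then have "of_int y / of_int x \<ge> (2::real)"
        by (simp add: field_simps)
      moreover have "(3 - sqrt 5) / 2 \<le> 1 / 2"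
        using s by simp
      ultimately have "1 \<le> \<bar>of_int y / of_int x - (3 - sqrt 5) / 2\<bar>"
        by linarith
      \<comment> \<open>The equation is symmetric, so (y, x) is a solution too, now with x as the
        large denominator.\<close>
      moreover have "y > 0" "y\<^sup>2 - 3 * y * x + x\<^sup>2 = -1"
        using xy by (simp_all add: algebra_simps)
      ultimately show ?thesis
        using xy(1) by blast
    qed
  qed
  ultimately show ?thesis
    by simp
qed

end
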